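(* Let $n \geq 1$ be an integer. The number of isomorphism classes of asymmetric subdivided stars on $n$ vertices equals the number of partitions of the integer $n-1$ into at least three parts, all parts being distinct positive integers.
   Context: All graphs are finite, undirected, without loops or multiple edges. A graph is asymmetric if its automorphism group (acting on vertices) is trivial. Subdividing an edge $uv$ means replacing it by two edges $uw$ and $wv$, where $w$ is a new vertex. A subdivided star is a graph that can be obtained from a star $K_{1,m}$ (for some $m \ge 1$) by performing one or more edge subdivisions (edges may be subdivided repeatedly). *)

theory Defs
  imports
    "Graph_Theory.Kuratowski"
    "Graph_Theory.Digraph_Isomorphism"
    "HOL-Library.Multiset"
begin

text \<open>
  A finite simple undirected graph is a \<^locale>\<open>pair_graph\<close>: a finite vertex set together with a
  finite, symmetric, loop-free arc relation, each edge \<open>uv\<close> being the pair of arcs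
  \<open>(u,v)\<close>, \<open>(v,u)\<close>. Its image under \<^const>\<open>with_proj\<close> is the same graph as a
  \<^typ>\<open>('a, 'a \<times> 'a) pre_digraph\<close>.
\<close>

text \<open>
  In an automorphism \<open>f\<close>, the equation \<open>app_iso f G = G\<close> makes \<open>f\<close> an isomorphism onto \<open>G\<close>
  itself, with the original tail and head maps. Outside \<open>verts G\<close> the map \<open>iso_verts f\<close> is
  arbitrary, so triviality of the action is only required on \<open>verts G\<close>.
\<close>

definition automorphism ::
    "('a, 'b) pre_digraph \<Rightarrow> ('a, 'b, 'a, 'b) digraph_isomorphism \<Rightarrow> bool" where
  "automorphism G f \<longleftrightarrow> pre_digraph.digraph_isomorphism G f \<and> app_iso f G = G"

definition asymmetric :: "'a pair_pre_digraph \<Rightarrow> bool" where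
  "asymmetric G \<longleftrightarrow>
     (\<forall>f. automorphism (with_proj G) f \<longrightarrow> (\<forall>v \<in> pverts G. iso_verts f v = v))"

text \<open>
  \<^const>\<open>subdivision\<close> permits zero subdivision steps; the last step is therefore spelled out to
  express that at least one edge is subdivided.
\<close>

definition subdivided_star :: "'a pair_pre_digraph \<Rightarrow> bool" where
  "subdivided_star G \<longleftrightarrow>
     (\<exists>m S H e w. m \<ge> 1 \<and> K\<^bsub>1,m\<^esub> (with_proj S) \<and> subdivision_pair S H \<and>
        e \<in> parcs H \<and> w \<notin> pverts H \<and> G = subdivide H e w)"

lemma pair_graph_subdivided_star:
  assumes "subdivided_star G"
  shows "pair_graph G"
  using assms unfolding subdivided_star_def
  by (blast intro: pair_graph.pair_graph_subdivide pair_graph.pair_graph_subdivision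
      pair_graphI_complete_bipartite)

definition graph_iso_rel :: "'a pair_pre_digraph rel" where
  "graph_iso_rel = {(G, H). digraph_iso (with_proj G) (with_proj H)}"

definition partition_of :: "nat multiset \<Rightarrow> nat \<Rightarrow> bool" where
  "partition_of P k \<longleftrightarrow> 0 \<notin># P \<and> sum_mset P = k"

end

theory Submission
  imports Defs "HOL-Combinatorics.Permutations"
begin

text \<open>
  A subdivided star is a spider: paths (legs) glued at a common end, the centre. Spiders with the
  same multiset of leg lengths are isomorphic. If there are at least three legs, the centre is the
  only vertex of degree above two and the legs are the maximal paths starting there, so the graph
  determines the multiset of leg lengths. Two legs of equal length can be swapped, and with at most
  two legs the graph is a path, which can be reversed; hence the asymmetric spiders are those with
  at least three legs, of pairwise distinct lengths, and on \<open>n\<close> vertices these lengths add up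
  to \<open>n - 1\<close>. Such a spider has a leg of length at least two, so at least one edge of the star was
  indeed subdivided.
\<close>

section \<open>Paths\<close>

fun path_arcs :: "'a list \<Rightarrow> 'a rel" where
  "path_arcs (x # y # xs) = {(x, y), (y, x)} \<union> path_arcs (y # xs)"
| "path_arcs _ = {}"

text \<open>The cut vertex \<open>y\<close> is kept in both halves, since otherwise the arcs across
  the cut would be lost.\<close>

lemma path_arcs_append: "path_arcs (xs @ y # ys) = path_arcs (xs @ [y]) \<union> path_arcs (y # ys)"
  by (induction xs rule: path_arcs.induct) auto

lemma path_arcs_rev: "path_arcs (rev xs) = path_arcs xs"
proof (induction xs rule: path_arcs.induct)
  case (1 x y xs)
  have "path_arcs (rev (x # y # xs)) = path_arcs (rev (y # xs)) \<union> path_arcs [y, x]"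
    using path_arcs_append[of "rev xs" y "[x]"] by simp
  then show ?case using 1 by auto
qed auto

lemma path_arcs_map: "path_arcs (map f xs) = map_prod f f ` path_arcs xs"
  by (induction xs rule: path_arcs.induct) auto

lemma path_arcs_subset: "path_arcs xs \<subseteq> set xs \<times> set xs"
  by (induction xs rule: path_arcs.induct) auto

lemma sym_path_arcs: "sym (path_arcs xs)"
  by (induction xs rule: path_arcs.induct) (auto simp: sym_def)

lemma finite_path_arcs: "finite (path_arcs xs)"
  by (rule finite_subset[OF path_arcs_subset]) simp

lemma path_arcs_irrefl: "distinct xs \<Longrightarrow> (x, x) \<notin> path_arcs xs"
  by (induction xs rule: path_arcs.induct) auto

lemma path_arcs_cases:
  assumes "(a, b) \<in> path_arcs xs"
  obtains ys u v zs where "xs = ys @ u # v # zs" "(a, b) = (u, v) \<or> (a, b) = (v, u)"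
  using assms
proof (induction xs arbitrary: thesis rule: path_arcs.induct)
  case (1 x y xs)
  show ?case
  proof (cases "(a, b) \<in> path_arcs (y # xs)")
    case True
    then obtain ys u v zs where "y # xs = ys @ u # v # zs" "(a, b) = (u, v) \<or> (a, b) = (v, u)"
      using 1(1) by blast
    then show ?thesis using 1(2)[of "x # ys"] by simp
  next
    case False
    then show ?thesis using 1(2)[of "[]"] 1(3) by auto
  qed
qed auto

text \<open>Cutting at \<open>u\<close> leaves two paths that start at \<open>u\<close>, the first
  one read backwards. On a path without repetition the only arc out of the first vertex leads to the
  second.\<close>

lemma path_arcs_neighbour:
  assumes "distinct (xs @ u # ys)" "(u, v) \<in> path_arcs (xs @ u # ys)"
  shows "xs \<noteq> [] \<and> v = last xs \<or> ys \<noteq> [] \<and> v = hd ys"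
proof -
  have *: "ys \<noteq> [] \<and> v = hd ys" if "distinct (u # ys)" "(u, v) \<in> path_arcs (u # ys)" for ys
    using that path_arcs_subset[of ys] by (cases ys) auto
  have "(u, v) \<in> path_arcs (u # rev xs) \<or> (u, v) \<in> path_arcs (u # ys)"
    using assms(2) path_arcs_rev[of "xs @ [u]"] by (subst (asm) path_arcs_append) auto
  then show ?thesis
    using *[of "rev xs"] *[of ys] assms(1) by (auto simp: hd_rev)
qed


section \<open>Spiders\<close>

text \<open>A spider is given by its centre and the list of its legs, each leg being listed from the
  neighbour of the centre outwards.\<close>

definition spider_legs :: "'a \<Rightarrow> 'a list list \<Rightarrow> bool" where
  "spider_legs c Ls \<longleftrightarrow> [] \<notin> set Ls \<and> distinct (c # concat Ls)"

definition spider :: "'a \<Rightarrow> 'a list list \<Rightarrow> 'a pair_pre_digraph" where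
  "spider c Ls = \<lparr>pverts = set (c # concat Ls), parcs = (\<Union>l\<in>set Ls. path_arcs (c # l))\<rparr>"

lemma pverts_spider [simp]: "pverts (spider c Ls) = insert c (\<Union>l\<in>set Ls. set l)"
  and parcs_spider: "parcs (spider c Ls) = (\<Union>l\<in>set Ls. path_arcs (c # l))"
  by (simp_all add: spider_def)

lemma spider_cong_set: "set Ls = set Ls' \<Longrightarrow> spider c Ls = spider c Ls'"
  by (simp add: spider_def)

lemma spider_legs_distinct_leg:
  "spider_legs c Ls \<Longrightarrow> l \<in> set Ls \<Longrightarrow> distinct (c # l)"
  by (auto simp: spider_legs_def distinct_concat_iff)

lemma spider_legs_disjoint:
  "spider_legs c Ls \<Longrightarrow> l \<in> set Ls \<Longrightarrow> l' \<in> set Ls \<Longrightarrow> x \<in> set l \<Longrightarrow> x \<in> set l' \<Longrightarrow> l = l'"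
  unfolding spider_legs_def distinct.simps distinct_concat_iff by blast

lemma spider_legs_nonempty: "spider_legs c Ls \<Longrightarrow> l \<in> set Ls \<Longrightarrow> l \<noteq> []"
  by (auto simp: spider_legs_def)

lemma spider_legs_distinct: "spider_legs c Ls \<Longrightarrow> distinct Ls"
  by (auto simp: spider_legs_def distinct_concat_iff)

lemma spider_legs_mset: "mset Ls = mset Ls' \<Longrightarrow> spider_legs c Ls \<Longrightarrow> spider_legs c Ls'"
  unfolding spider_legs_def distinct.simps set_concat distinct_concat_iff
  by (metis mset_eq_imp_distinct_iff mset_eq_setD mset_filter removeAll_filter_not_eq)

lemma pair_graph_spider:
  assumes "spider_legs c Ls"
  shows "pair_graph (spider c Ls)"
proof unfold_locales
  fix e assume "e \<in> parcs (spider c Ls)"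
  then obtain l where l: "l \<in> set Ls" "e \<in> path_arcs (c # l)"
    by (auto simp: parcs_spider)
  show "fst e \<in> pverts (spider c Ls)" "snd e \<in> pverts (spider c Ls)"
    using l path_arcs_subset[of "c # l"] by fastforce+
  show "fst e \<noteq> snd e"
    using l spider_legs_distinct_leg[OF assms] path_arcs_irrefl by (metis prod.collapse)
next
  show "finite (parcs (spider c Ls))" by (simp add: parcs_spider finite_path_arcs)
  show "symmetric (spider c Ls)"
    unfolding symmetric_def with_proj_simps parcs_spider
    by (intro sym_UNION ballI sym_path_arcs)
qed simp

lemma pair_wf_digraph_spider:
  assumes "spider_legs c Ls"
  shows "pair_wf_digraph (spider c Ls)"
proof -
  interpret pair_graph "spider c Ls" using assms by (rule pair_graph_spider)
  show ?thesis ..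
qed

lemma card_pverts_spider:
  assumes "spider_legs c Ls"
  shows "card (pverts (spider c Ls)) = Suc (sum_list (map length Ls))"
proof -
  have "card (set (c # concat Ls)) = length (c # concat Ls)"
    using assms unfolding spider_legs_def by (blast intro: distinct_card)
  then show ?thesis by (simp add: length_concat)
qed

section \<open>Neighbours in a spider, and how they determine the centre and the legs\<close>

lemma spider_arc_leg:
  assumes "spider_legs c Ls" "l \<in> set Ls" "u \<in> set l" "(u, v) \<in> parcs (spider c Ls)"
  shows "(u, v) \<in> path_arcs (c # l)"
proof -
  obtain l' where l': "l' \<in> set Ls" "(u, v) \<in> path_arcs (c # l')"
    using assms(4) by (auto simp: parcs_spider)
  then have "u \<in> set (c # l')" using path_arcs_subset[of "c # l'"] by auto
  moreover have "u \<noteq> c" using assms spider_legs_distinct_leg by fastforce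
  ultimately show ?thesis using l' spider_legs_disjoint[OF assms(1,2) l'(1) assms(3)] by auto
qed

text \<open>The arc stays on the leg of \<open>u\<close>, so this is the statement about paths
  applied to \<open>c # xs @ u # ys\<close>. The term \<open>last (c # xs)\<close> is the vertex
  before \<open>u\<close>, which is the centre if \<open>u\<close> begins its leg.\<close>

lemma spider_neighbour:
  assumes "spider_legs c Ls" "xs @ u # ys \<in> set Ls" "(u, v) \<in> parcs (spider c Ls)"
  shows "v = last (c # xs) \<or> ys \<noteq> [] \<and> v = hd ys"
  using path_arcs_neighbour[of "c # xs" u ys v] spider_legs_distinct_leg[OF assms(1,2)]
    spider_arc_leg[OF assms(1,2) _ assms(3)] by auto

lemma spider_centre_neighbour:
  assumes "spider_legs c Ls"
  shows "(c, v) \<in> parcs (spider c Ls) \<longleftrightarrow> v \<in> hd ` set Ls"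
proof
  assume "(c, v) \<in> parcs (spider c Ls)"
  then obtain l where l: "l \<in> set Ls" "(c, v) \<in> path_arcs (c # l)"
    by (auto simp: parcs_spider)
  then show "v \<in> hd ` set Ls"
    using path_arcs_neighbour[of "[]" c l v] spider_legs_distinct_leg[OF assms] by auto
next
  assume "v \<in> hd ` set Ls"
  then obtain l where l: "l \<in> set Ls" "v = hd l" by auto
  then have "l = v # tl l" using spider_legs_nonempty[OF assms] by simp
  then have "(c, v) \<in> path_arcs (c # l)" by (metis UnI1 insertI1 path_arcs.simps(1))
  then show "(c, v) \<in> parcs (spider c Ls)" using l by (auto simp: parcs_spider)
qed

lemma card_centre_neighbours:
  assumes "spider_legs c Ls"
  shows "card {v. (c, v) \<in> parcs (spider c Ls)} = length Ls"
proof -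
  have "inj_on hd (set Ls)"
    using spider_legs_disjoint[OF assms] assms
    by (intro inj_onI) (metis hd_in_set spider_legs_def)
  then show ?thesis
    using spider_legs_distinct[OF assms]
    by (simp add: spider_centre_neighbour[OF assms] card_image distinct_card)
qed

lemma card_noncentre_neighbours:
  assumes "spider_legs c Ls" "u \<in> pverts (spider c Ls)" "u \<noteq> c"
  shows "card {v. (u, v) \<in> parcs (spider c Ls)} \<le> 2"
proof -
  obtain l where l: "l \<in> set Ls" "u \<in> set l" using assms by auto
  then obtain xs ys where "l = xs @ u # ys" by (meson split_list)
  then have "{v. (u, v) \<in> parcs (spider c Ls)} \<subseteq> {last (c # xs), hd ys}"
    using spider_neighbour[OF assms(1)] l by blast
  then have "card {v. (u, v) \<in> parcs (spider c Ls)} \<le> card {last (c # xs), hd ys}"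
    by (intro card_mono) auto
  also have "\<dots> \<le> 2" by (simp add: card_insert_if)
  finally show ?thesis .
qed

text \<open>The path is extended at its far end. Its first step selects a leg; from then on, one of
  the at most two neighbours of the current end has already been visited, so the path can only
  follow that leg outwards.\<close>

lemma path_from_centre_prefix:
  assumes "spider_legs c Ls" "l \<noteq> []" "distinct (c # l)"
    and "path_arcs (c # l) \<subseteq> parcs (spider c Ls)"
  shows "\<exists>ys. l @ ys \<in> set Ls"
  using assms(2-)
proof (induction l rule: rev_induct)
  case (snoc v l)
  show ?case
  proof (cases l rule: rev_cases)
    case Nil
    then have "v \<in> hd ` set Ls"
      using snoc.prems spider_centre_neighbour[OF assms(1), of v] by auto
    then obtain l' where "l' \<in> set Ls" "v = hd l'" by auto
    moreover have "l' = hd l' # tl l'"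
      using spider_legs_nonempty[OF assms(1)] calculation by simp
    ultimately show ?thesis using Nil by (metis append_Cons append_Nil)
  next
    case (snoc l1 u)
    have split: "path_arcs (c # l @ [v]) = path_arcs (c # l) \<union> path_arcs [u, v]"
      using path_arcs_append[of "c # l1" u "[v]"] snoc by simp
    then obtain ys where ys: "l @ ys \<in> set Ls"
      using snoc.IH snoc.prems snoc by auto
    have "(u, v) \<in> parcs (spider c Ls)" using split snoc.prems by auto
    then have "v = last (c # l1) \<or> ys \<noteq> [] \<and> v = hd ys"
      using spider_neighbour[OF assms(1), of l1 u ys v] ys snoc by simp
    \<comment> \<open>Turning back is impossible: this vertex is on the path already.\<close>
    moreover have "v \<noteq> last (c # l1)"
      using snoc.prems snoc last_in_set[of "c # l1"] by (auto split: if_splits)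
    ultimately have "(l @ [v]) @ tl ys \<in> set Ls" using ys by (cases ys) auto
    then show ?thesis by blast
  qed
qed simp

text \<open>A leg of either presentation is a path from the centre and hence a prefix of a leg of
  the other. Going there and back extends a leg to one of the same presentation, which meets it and
  so equals it; both extensions are therefore empty.\<close>

lemma spider_unique_legs_subset:
  assumes "spider_legs c Ls" "spider_legs c Ls'" "spider c Ls = spider c Ls'"
  shows "set Ls \<subseteq> set Ls'"
proof
  have prefix: "\<exists>ys. l @ ys \<in> set B"
    if "spider_legs c A" "spider_legs c B" "spider c A = spider c B" "l \<in> set A" for l A B
  proof (rule path_from_centre_prefix[OF that(2)])
    show "l \<noteq> []" by (rule spider_legs_nonempty[OF that(1,4)])
    show "distinct (c # l)" by (rule spider_legs_distinct_leg[OF that(1,4)])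
    show "path_arcs (c # l) \<subseteq> parcs (spider c B)"
      using that(4) by (auto simp: that(3)[symmetric] parcs_spider)
  qed
  fix l assume l: "l \<in> set Ls"
  then obtain ys where ys: "l @ ys \<in> set Ls'" using prefix[OF assms] by blast
  then obtain zs where "(l @ ys) @ zs \<in> set Ls"
    using prefix[OF assms(2,1) assms(3)[symmetric]] by blast
  moreover have "hd l \<in> set l" using spider_legs_nonempty[OF assms(1) l] by simp
  ultimately have "l = (l @ ys) @ zs"
    using spider_legs_disjoint[OF assms(1) l] by (metis Un_iff set_append)
  then show "l \<in> set Ls'" using ys by simp
qed

text \<open>Three legs give \<open>c'\<close> at least three neighbours, whereas every vertex other
  than \<open>c\<close> has at most two.\<close>

lemma spider_unique:
  assumes "spider_legs c Ls" "spider_legs c' Ls'" "spider c Ls = spider c' Ls'"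
    and "length Ls' \<ge> 3"
  shows "c = c'" "mset Ls = mset Ls'"
proof -
  have "c' \<in> pverts (spider c Ls)" by (simp only: assms(3)) simp
  then show c: "c = c'"
    using card_noncentre_neighbours[OF assms(1), of c'] card_centre_neighbours[OF assms(2)]
      assms(3,4) by fastforce
  then have "set Ls = set Ls'"
    using assms(1-3) spider_unique_legs_subset[of c Ls Ls'] spider_unique_legs_subset[of c Ls' Ls]
    by auto
  then show "mset Ls = mset Ls'"
    using assms(1,2) spider_legs_distinct set_eq_iff_mset_eq_distinct by metis
qed


section \<open>Isomorphisms\<close>

text \<open>An isomorphism of simple graphs amounts to an injective relabelling of vertices. This
  form replaces the records of vertex, arc, head and tail maps in all that follows.\<close>

definition map_graph :: "('a \<Rightarrow> 'b) \<Rightarrow> 'a pair_pre_digraph \<Rightarrow> 'b pair_pre_digraph" where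
  "map_graph f G = \<lparr>pverts = f ` pverts G, parcs = map_prod f f ` parcs G\<rparr>"

text \<open>Tail and head are the projections on both sides, so the arc map has no freedom: it must
  apply the vertex map to both ends.\<close>

lemma map_graph_of_isomorphism:
  assumes "pre_digraph.digraph_isomorphism (with_proj G) h"
    and "with_proj H = app_iso h (with_proj G)"
  shows "inj_on (iso_verts h) (pverts G)" "H = map_graph (iso_verts h) G"
proof -
  have V: "pverts H = iso_verts h ` pverts G" and A: "parcs H = iso_arcs h ` parcs G"
    and T: "iso_tail h = fst" "iso_head h = snd"
    using assms(2) by (auto simp: with_proj_def app_iso_def)
  have "iso_arcs h e = map_prod (iso_verts h) (iso_verts h) e" if "e \<in> parcs G" for e
    using assms(1) that T unfolding pre_digraph.digraph_isomorphism_def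
    by (cases e) (auto simp: prod_eq_iff)
  then have "parcs H = map_prod (iso_verts h) (iso_verts h) ` parcs G"
    using A by (auto simp: image_iff)
  then show "H = map_graph (iso_verts h) G" using V by (simp add: map_graph_def)
  show "inj_on (iso_verts h) (pverts G)"
    using assms(1) unfolding pre_digraph.digraph_isomorphism_def by simp
qed

lemma isomorphism_of_map_graph:
  assumes "pair_wf_digraph G" "inj_on f (pverts G)"
  defines "h \<equiv> \<lparr>iso_verts = f, iso_arcs = map_prod f f, iso_head = snd, iso_tail = fst\<rparr>"
  shows "pre_digraph.digraph_isomorphism (with_proj G) h"
    and "with_proj (map_graph f G) = app_iso h (with_proj G)"
proof -
  interpret pair_wf_digraph G by fact
  have "parcs G \<subseteq> pverts G \<times> pverts G" using wellformed' by auto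
  then have "inj_on (map_prod f f) (parcs G)"
    by (rule inj_on_subset[OF map_prod_inj_on[OF assms(2) assms(2)]])
  then show "pre_digraph.digraph_isomorphism (with_proj G) h"
    using assms(1,2) by (simp add: pre_digraph.digraph_isomorphism_def h_def wf_digraph_wp_iff)
  show "with_proj (map_graph f G) = app_iso h (with_proj G)"
    by (simp add: h_def with_proj_def app_iso_def map_graph_def)
qed

lemma digraph_iso_iff_map_graph:
  assumes "pair_wf_digraph G"
  shows "digraph_iso (with_proj G) (with_proj H) \<longleftrightarrow> (\<exists>f. inj_on f (pverts G) \<and> H = map_graph f G)"
  unfolding digraph_iso_def
  using map_graph_of_isomorphism isomorphism_of_map_graph[OF assms] by metis

lemma digraph_iso_refl:
  assumes "pair_wf_digraph G"
  shows "digraph_iso (with_proj G) (with_proj G)"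
proof -
  have "G = map_graph id G" by (simp add: map_graph_def prod.map_id0)
  then show ?thesis
    unfolding digraph_iso_iff_map_graph[OF assms] by (intro exI[of _ id] conjI inj_on_id)
qed

lemma asymmetric_iff_map_graph:
  assumes "pair_wf_digraph G"
  shows "asymmetric G \<longleftrightarrow>
    (\<forall>f. inj_on f (pverts G) \<and> map_graph f G = G \<longrightarrow> (\<forall>v\<in>pverts G. f v = v))"
proof (intro iffI allI impI ballI)
  fix f v
  assume "asymmetric G" and f: "inj_on f (pverts G) \<and> map_graph f G = G" and "v \<in> pverts G"
  then show "f v = v"
    using isomorphism_of_map_graph[OF assms, of f]
    unfolding asymmetric_def automorphism_def by force
next
  assume *: "\<forall>f. inj_on f (pverts G) \<and> map_graph f G = G \<longrightarrow> (\<forall>v\<in>pverts G. f v = v)"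
  show "asymmetric G"
    unfolding asymmetric_def automorphism_def
    using map_graph_of_isomorphism[of G _ G] * by metis
qed

section \<open>Isomorphisms between spiders and multisets of leg lengths\<close>

lemma map_graph_spider: "map_graph f (spider c Ls) = spider (f c) (map (map f) Ls)"
  unfolding map_graph_def spider_def
  by (simp add: image_UN image_Un path_arcs_map[symmetric])

lemma spider_legs_map:
  assumes "spider_legs c Ls" "inj_on f (pverts (spider c Ls))"
  shows "spider_legs (f c) (map (map f) Ls)"
proof -
  have "distinct (map f (c # concat Ls))"
    using assms unfolding distinct_map by (simp add: spider_legs_def)
  then show ?thesis using assms(1) by (auto simp: spider_legs_def map_concat)
qed

lemma ex_map_eq_if_distinct:
  assumes "distinct xs" "length xs = length ys"
  shows "\<exists>f. map f xs = ys"
  using assms(2,1)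
proof (induction xs ys rule: list_induct2)
  case (Cons x xs y ys)
  then obtain f where "map f xs = ys" by auto
  then have "map (f(x := y)) (x # xs) = y # ys" using Cons.prems by simp
  then show ?case by (intro exI[of _ "f(x := y)"])
qed simp

text \<open>The centre followed by the concatenated legs lists every vertex exactly once;
  \<open>f\<close> matches two such lists position by position.\<close>

lemma spider_isomorphism:
  assumes "spider_legs c Ls" "spider_legs c' Ls'" "map length Ls = map length Ls'"
  obtains f where "inj_on f (pverts (spider c Ls))" "f c = c'" "map (map f) Ls = Ls'"
proof -
  let ?xs = "c # concat Ls" and ?ys = "c' # concat Ls'"
  have len: "length ?xs = length ?ys" by (simp add: length_concat assms(3))
  have dist: "distinct ?xs" "distinct ?ys" using assms by (auto simp: spider_legs_def)
  obtain f where map: "map f ?xs = ?ys" using ex_map_eq_if_distinct[OF dist(1) len] ..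
  have "inj_on f (set ?xs)" using dist map distinct_map by metis
  \<comment> \<open>So far \<open>f\<close> is known on the concatenations only; equal leg lengths
    mean that both are cut at the same places.\<close>
  moreover have "map (map f) Ls = Ls'"
  proof (rule concat_injective)
    show "concat (map (map f) Ls) = concat Ls'" using map by (simp add: map_concat)
    show "length (map (map f) Ls) = length Ls'" using assms(3) map_eq_imp_length_eq by fastforce
    show "\<forall>(x, y)\<in>set (zip (map (map f) Ls) Ls'). length x = length y"
      using assms(3) by (auto simp: set_zip list_eq_iff_nth_eq)
  qed
  ultimately show thesis using that map by simp
qed

text \<open>Reordering the legs does not change the graph, so equal multisets of lengths reduce to
  equal lists of lengths.\<close>

lemma spider_iso_if_mset_lengths:
  assumes "spider_legs c Ls" "spider_legs c' Ls'"
    and "mset (map length Ls) = mset (map length Ls')"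
  shows "digraph_iso (with_proj (spider c Ls)) (with_proj (spider c' Ls'))"
proof -
  obtain p where p: "p permutes {..<length Ls'}" "permute_list p (map length Ls') = map length Ls"
    using mset_eq_permutation[OF assms(3)] by auto
  define Ks where "Ks = permute_list p Ls'"
  have Ks: "mset Ks = mset Ls'" "map length Ks = map length Ls"
    using p by (simp_all add: Ks_def permute_list_map)
  have legs: "spider_legs c' Ks"
    using spider_legs_mset[OF Ks(1)[symmetric] assms(2)] .
  obtain f where "inj_on f (pverts (spider c Ls))" "f c = c'" "map (map f) Ls = Ks"
    using spider_isomorphism[OF assms(1) legs Ks(2)[symmetric]] by blast
  moreover have "spider c' Ks = spider c' Ls'"
    using Ks(1) by (intro spider_cong_set) (rule mset_eq_setD)
  ultimately show ?thesis
    unfolding digraph_iso_iff_map_graph[OF pair_wf_digraph_spider[OF assms(1)]]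
    by (intro exI[of _ f]) (simp add: map_graph_spider)
qed

lemma mset_lengths_if_spider_iso:
  assumes "spider_legs c Ls" "spider_legs c' Ls'" "length Ls' \<ge> 3"
    and "digraph_iso (with_proj (spider c Ls)) (with_proj (spider c' Ls'))"
  shows "mset (map length Ls) = mset (map length Ls')"
proof -
  obtain f where f: "inj_on f (pverts (spider c Ls))" "spider c' Ls' = spider (f c) (map (map f) Ls)"
    using assms(4) unfolding digraph_iso_iff_map_graph[OF pair_wf_digraph_spider[OF assms(1)]]
    by (auto simp only: map_graph_spider)
  have "mset (map (map f) Ls) = mset Ls'"
    using spider_unique(2)[OF spider_legs_map[OF assms(1) f(1)] assms(2) f(2)[symmetric] assms(3)] .
  then have "mset (map length (map (map f) Ls)) = mset (map length Ls')"
    unfolding mset_map[of length] by (rule arg_cong)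
  then show ?thesis by (simp add: comp_def)
qed


section \<open>Asymmetric spiders\<close>

text \<open>Two presentations of one graph with the same list of lengths yield an automorphism
  carrying the first to the second, and asymmetry makes it the identity. A symmetry can thus be
  excluded by exhibiting a second presentation.\<close>

lemma asymmetric_spider_rigid:
  assumes "spider_legs c Ls" "spider_legs c' Ls'" "spider c Ls = spider c' Ls'"
    and "map length Ls = map length Ls'" "asymmetric (spider c Ls)"
  shows "c = c'" "Ls = Ls'"
proof -
  obtain f where f: "inj_on f (pverts (spider c Ls))" "f c = c'" "map (map f) Ls = Ls'"
    using spider_isomorphism[OF assms(1,2,4)] by blast
  from f(2,3) have "map_graph f (spider c Ls) = spider c' Ls'" by (simp only: map_graph_spider)
  then have "map_graph f (spider c Ls) = spider c Ls" by (simp only: assms(3))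
  then have fixed: "\<forall>v\<in>pverts (spider c Ls). f v = v"
    using assms(5) f(1) unfolding asymmetric_iff_map_graph[OF pair_wf_digraph_spider[OF assms(1)]]
    by blast
  then show "c = c'" using f(2) by simp
  have "map (map f) Ls = map (map id) Ls"
    using fixed by (intro map_cong refl) simp
  then show "Ls = Ls'" using f(3) by simp
qed

lemma asymmetric_spider_not_path:
  assumes "spider_legs c [l]"
  shows "\<not> asymmetric (spider c [l])"
proof
  assume asym: "asymmetric (spider c [l])"
  \<comment> \<open>The second presentation reads the path from its other end
    \<open>d\<close>.\<close>
  obtain d l' where rev: "rev (c # l) = d # l'"
    by (metis list.exhaust rev_is_Nil_conv list.distinct(1))
  have len: "length l' = length l" using arg_cong[OF rev, of length] by simp
  have set: "set (d # l') = set (c # l)" using rev by (metis set_rev)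
  have dist: "distinct (d # l')"
    using assms rev by (metis distinct_rev spider_legs_distinct_leg list.set_intros(1))
  have "l \<noteq> []" using spider_legs_nonempty[OF assms] by simp
  then have "l' \<noteq> []" using len by auto
  then have legs: "spider_legs d [l']" using dist by (simp add: spider_legs_def)
  have "path_arcs (d # l') = path_arcs (c # l)" using rev path_arcs_rev by metis
  then have "spider c [l] = spider d [l']" using set by (simp add: spider_def)
  then have "c = d" using asymmetric_spider_rigid(1)[OF assms legs _ _ asym] len by simp
  moreover have "d = last l" using rev \<open>l \<noteq> []\<close> by (metis hd_rev last_ConsR list.sel(1))
  ultimately show False using assms \<open>l \<noteq> []\<close> by (auto simp: spider_legs_def)
qed

text \<open>Walking inwards along the first leg from its far end \<open>d\<close>, through
  \<open>c\<close>, and outwards along the second traverses the whole graph as a single leg.\<close>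

lemma spider_two_legs_eq_path:
  assumes "spider_legs c [l1, l2]"
  obtains d l where "spider_legs d [l]" "spider c [l1, l2] = spider d [l]"
proof -
  have "l1 \<noteq> []" using spider_legs_nonempty[OF assms] by simp
  then obtain d l where dl: "rev l1 = d # l" by (metis list.exhaust rev_is_Nil_conv)
  have eq: "d # l @ c # l2 = rev l1 @ c # l2" using dl by simp
  have "path_arcs (d # l @ c # l2) = path_arcs (rev (c # l1)) \<union> path_arcs (c # l2)"
    unfolding eq by (subst path_arcs_append) simp
  moreover have "set (d # l @ c # l2) = insert c (set l1 \<union> set l2)" unfolding eq by auto
  ultimately have "spider c [l1, l2] = spider d [l @ c # l2]"
    by (simp only: path_arcs_rev) (simp add: spider_def)
  moreover have "distinct (d # l @ c # l2)"
    unfolding eq using assms by (auto simp: spider_legs_def)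
  then have "spider_legs d [l @ c # l2]" by (simp add: spider_legs_def)
  ultimately show thesis using that by blast
qed

text \<open>One or two legs form a path, which has a reversal. The empty list is excluded because a
  single vertex is asymmetric.\<close>

lemma asymmetric_spider_length:
  assumes "spider_legs c Ls" "Ls \<noteq> []" "asymmetric (spider c Ls)"
  shows "length Ls \<ge> 3"
proof (rule ccontr)
  assume "\<not> length Ls \<ge> 3"
  then have "length Ls = 1 \<or> length Ls = 2" using assms(2)
    by (metis One_nat_def Suc_leI le_antisym length_greater_0_conv not_less_eq_eq numeral_2_eq_2 numeral_3_eq_3)
  then consider l where "Ls = [l]" | l1 l2 where "Ls = [l1, l2]"
    by (auto simp: numeral_2_eq_2 length_Suc_conv)
  then show False
  proof cases
    case 1
    then show False using asymmetric_spider_not_path assms by metis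
  next
    case 2
    then show False using asymmetric_spider_not_path spider_two_legs_eq_path assms by metis
  qed
qed

lemma asymmetric_spider_distinct_lengths:
  assumes "spider_legs c Ls" "asymmetric (spider c Ls)"
  shows "distinct (map length Ls)"
proof (rule ccontr)
  assume "\<not> distinct (map length Ls)"
  then obtain i j where ij: "i < length Ls" "j < length Ls" "i \<noteq> j" "length (Ls ! i) = length (Ls ! j)"
    by (auto simp: distinct_conv_nth)
  \<comment> \<open>Exchanging two legs of equal length preserves the graph and the list of lengths
    but not the list of legs.\<close>
  define Ls' where "Ls' = Ls[i := Ls ! j, j := Ls ! i]"
  have mset: "mset Ls' = mset Ls" using ij by (simp add: Ls'_def mset_swap)
  have "map length Ls = map length Ls'"
    using ij by (auto simp: Ls'_def list_eq_iff_nth_eq nth_list_update)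
  moreover have "spider c Ls = spider c Ls'"
    using mset by (intro spider_cong_set) (metis mset_eq_setD)
  ultimately have "Ls = Ls'"
    using asymmetric_spider_rigid(2)[OF assms(1) spider_legs_mset[OF mset[symmetric] assms(1)]] assms(2)
    by blast
  then have "Ls ! i = Ls ! j"
    using ij by (metis Ls'_def length_list_update nth_list_update_eq nth_list_update_neq)
  then show False
    using spider_legs_distinct[OF assms(1)] ij by (simp add: nth_eq_iff_index_eq)
qed

text \<open>An automorphism turns the spider into another presentation of the same graph. By
  uniqueness it fixes the centre and permutes the legs, and since it preserves lengths, it maps each
  leg to itself, vertex by vertex from the centre outwards.\<close>

lemma asymmetric_spiderI:
  assumes "spider_legs c Ls" "length Ls \<ge> 3" "distinct (map length Ls)"
  shows "asymmetric (spider c Ls)"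
  unfolding asymmetric_iff_map_graph[OF pair_wf_digraph_spider[OF assms(1)]]
proof (intro allI impI ballI; elim conjE)
  fix f v
  assume inj: "inj_on f (pverts (spider c Ls))" and "map_graph f (spider c Ls) = spider c Ls"
    and v: "v \<in> pverts (spider c Ls)"
  then have eq: "spider (f c) (map (map f) Ls) = spider c Ls" by (simp add: map_graph_spider)
  note unique = spider_unique[OF spider_legs_map[OF assms(1) inj] assms(1) eq assms(2)]
  have "map f l = l" if l: "l \<in> set Ls" for l
  proof -
    have "map f l \<in> set (map (map f) Ls)" using l by simp
    then have "map f l \<in> set Ls" using unique(2) mset_eq_setD by metis
    then show ?thesis
      using assms(3) l unfolding distinct_map by (metis inj_onD length_map)
  qed
  then show "f v = v" using v unique(1) map_eq_conv[of f _ id] by auto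
qed


section \<open>Subdivided stars are spiders\<close>

lemma subdivide_swap: "subdivide G (u, v) w = subdivide G (v, u) w"
  by (auto simp: subdivide.simps)

text \<open>The subdivided edge is given by its outer end \<open>v\<close>; its inner end
  \<open>last (c # xs)\<close> is the centre if \<open>v\<close> begins the leg. The new vertex goes
  just before \<open>v\<close>.\<close>

lemma spider_subdivide:
  assumes legs: "spider_legs c (Ls1 @ (xs @ v # ys) # Ls2)"
    and w: "w \<notin> pverts (spider c (Ls1 @ (xs @ v # ys) # Ls2))"
  shows "spider_legs c (Ls1 @ (xs @ w # v # ys) # Ls2)"
    and "subdivide (spider c (Ls1 @ (xs @ v # ys) # Ls2)) (last (c # xs), v) w =
      spider c (Ls1 @ (xs @ w # v # ys) # Ls2)"
proof -
  show "spider_legs c (Ls1 @ (xs @ w # v # ys) # Ls2)"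
    using legs w by (auto simp: spider_legs_def)
  define u where "u = last (c # xs)"
  define zs where "zs = butlast (c # xs)"
  have zs: "c # xs = zs @ [u]" unfolding zs_def u_def by (metis append_butlast_last_id list.distinct(1))
  have cat: "c # xs @ r = zs @ u # r" for r using arg_cong[OF zs, of "\<lambda>a. a @ r"] by simp
  \<comment> \<open>\<open>R\<close> holds the arcs of the other legs, \<open>A\<close> all arcs
    except the two of the subdivided edge. Only \<open>A\<close> is common to the graphs before and
    after.\<close>
  define R where "R = (\<Union>l\<in>set (Ls1 @ Ls2). path_arcs (c # l))"
  define A where "A = path_arcs (c # xs) \<union> R \<union> path_arcs (v # ys)"
  have old: "path_arcs (c # xs @ v # ys) = path_arcs (c # xs) \<union> {(u, v), (v, u)} \<union> path_arcs (v # ys)"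
    using path_arcs_append[of zs u "v # ys"] unfolding zs cat by auto
  have new: "path_arcs (c # xs @ w # v # ys) =
      path_arcs (c # xs) \<union> {(u, w), (w, u), (w, v), (v, w)} \<union> path_arcs (v # ys)"
    using path_arcs_append[of zs u "w # v # ys"] unfolding zs cat by auto
  have "u \<in> insert c (set xs)" unfolding u_def by simp
  \<comment> \<open>If \<open>u\<close> is the centre it lies on every extended leg, so for the
    other legs it is \<open>v\<close> that has to be missing.\<close>
  then have "u \<notin> set (v # ys)" "v \<notin> set (c # xs)" "\<And>l. l \<in> set (Ls1 @ Ls2) \<Longrightarrow> v \<notin> set (c # l)"
    using legs by (auto simp: spider_legs_def)
  then have "(u, v) \<notin> A" "(v, u) \<notin> A"
    unfolding A_def R_def using path_arcs_subset by fastforce+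
  moreover have "parcs (spider c (Ls1 @ (xs @ v # ys) # Ls2)) = A \<union> {(u, v), (v, u)}"
    unfolding parcs_spider A_def R_def using old by auto
  moreover have "parcs (spider c (Ls1 @ (xs @ w # v # ys) # Ls2)) =
      A \<union> {(u, w), (w, u), (w, v), (v, w)}"
    unfolding parcs_spider A_def R_def using new by auto
  ultimately show "subdivide (spider c (Ls1 @ (xs @ v # ys) # Ls2)) (last (c # xs), v) w =
      spider c (Ls1 @ (xs @ w # v # ys) # Ls2)"
    unfolding u_def[symmetric] by (intro pair_pre_digraph.equality) auto
qed

lemma subdivide_spider:
  assumes legs: "spider_legs c Ls" and e: "e \<in> parcs (spider c Ls)" and w: "w \<notin> pverts (spider c Ls)"
  shows "\<exists>Ls'. spider_legs c Ls' \<and> Ls' \<noteq> [] \<and> subdivide (spider c Ls) e w = spider c Ls'"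
proof -
  obtain a b where ab: "e = (a, b)" by (cases e)
  obtain l where l: "l \<in> set Ls" "(a, b) \<in> path_arcs (c # l)"
    using e by (auto simp: ab parcs_spider)
  obtain zs u v ys where uv: "c # l = zs @ u # v # ys" "(a, b) = (u, v) \<or> (a, b) = (v, u)"
    using l(2) by (rule path_arcs_cases)
  \<comment> \<open>The part of the leg up to \<open>u\<close>, without the centre; it is empty if
    \<open>u\<close> is the centre.\<close>
  define xs where "xs = tl (zs @ [u])"
  have xs: "c # xs = zs @ [u]" unfolding xs_def using uv(1) by (cases zs) auto
  then have "l = xs @ v # ys" "last (c # xs) = u"
    using uv(1) by (auto simp: xs_def tl_append split: list.splits)
  moreover obtain Ls1 Ls2 where "Ls = Ls1 @ l # Ls2" using l(1) by (meson split_list)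
  ultimately have Ls: "Ls = Ls1 @ (xs @ v # ys) # Ls2" and u: "last (c # xs) = u" by simp_all
  let ?Ls' = "Ls1 @ (xs @ w # v # ys) # Ls2"
  note sub = spider_subdivide[OF legs[unfolded Ls] w[unfolded Ls]]
  have "subdivide (spider c Ls) e w = subdivide (spider c Ls) (u, v) w"
    using uv(2) by (auto simp: ab subdivide_swap[of _ v])
  also have "\<dots> = spider c ?Ls'" using sub(2) by (simp only: Ls u)
  finally show ?thesis using sub(1) by (intro exI[of _ ?Ls'] conjI) simp_all
qed

lemma spider_star:
  "spider c (map (\<lambda>x. [x]) xs) =
    \<lparr>pverts = {c} \<union> set xs, parcs = {c} \<times> set xs \<union> set xs \<times> {c}\<rparr>"
  by (auto simp: spider_def)

text \<open>A star is a spider whose legs are single vertices, and each subdivision lengthens one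
  leg by a vertex.\<close>

lemma subdivision_star_spider:
  assumes "K\<^bsub>1,m\<^esub> (with_proj S)" "m \<ge> 1" "subdivision_pair S H"
  shows "\<exists>c Ls. spider_legs c Ls \<and> Ls \<noteq> [] \<and> H = spider c Ls"
  using assms(3)
proof (induction rule: subdivision_pair_induct)
  case base
  obtain U V where UV: "pverts S = U \<union> V" "U \<inter> V = {}" "card U = 1" "card V = m"
      "parcs S = U \<times> V \<union> V \<times> U"
    using assms(1) unfolding complete_bipartite_digraph_pair_def by blast
  obtain c where c: "U = {c}" using UV(3) card_1_singletonE by blast
  have "finite V" using UV(4) assms(2) card.infinite by fastforce
  then obtain xs where xs: "set xs = V" "distinct xs" using finite_distinct_list by blast
  have "S = spider c (map (\<lambda>x. [x]) xs)"
    unfolding spider_star xs(1) using UV(1,5) c by (intro pair_pre_digraph.equality) simp_all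
  moreover have "spider_legs c (map (\<lambda>x. [x]) xs)"
    using UV(2) c xs by (auto simp: spider_legs_def)
  moreover have "xs \<noteq> []" using UV(4) xs(1) assms(2) by auto
  ultimately show ?case by (intro exI[of _ c] exI[of _ "map (\<lambda>x. [x]) xs"] conjI) simp_all
next
  case (divide e w H)
  from divide.IH obtain c Ls where H: "spider_legs c Ls" "H = spider c Ls" by (elim exE conjE)
  show ?case
    by (rule exI[of _ c], rule subdivide_spider[OF H(1), folded H(2), OF divide.hyps(1,2)])
qed

lemma spider_if_subdivided_star:
  assumes "subdivided_star G"
  obtains c Ls where "spider_legs c Ls" "Ls \<noteq> []" "G = spider c Ls"
proof -
  obtain m S H e w where *: "m \<ge> 1" "K\<^bsub>1,m\<^esub> (with_proj S)" "subdivision_pair S H"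
      "e \<in> parcs H" "w \<notin> pverts H" "G = subdivide H e w"
    using assms unfolding subdivided_star_def by blast
  obtain c Ls where H: "spider_legs c Ls" "H = spider c Ls"
    using subdivision_star_spider[OF *(2,1,3)] by (elim exE conjE)
  obtain Ls' where Ls': "spider_legs c Ls'" "Ls' \<noteq> []" "subdivide H e w = spider c Ls'"
    using subdivide_spider[OF H(1), folded H(2), OF *(4,5)] by (elim exE conjE)
  show thesis by (rule that[OF Ls'(1,2) trans[OF *(6) Ls'(3)]])
qed

section \<open>Spiders with a leg of length at least two are subdivided stars\<close>

lemma spider_unsubdivide:
  assumes "spider_legs c Ls" "l \<in> set Ls" "length l \<ge> 2"
  obtains Ls' e w where "spider_legs c Ls'" "Ls' \<noteq> []" "length (concat Ls') < length (concat Ls)"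
    "e \<in> parcs (spider c Ls')" "w \<notin> pverts (spider c Ls')" "spider c Ls = subdivide (spider c Ls') e w"
proof -
  \<comment> \<open>The first vertex \<open>w\<close> of the leg is the one to suppress: it
    subdivides the edge from \<open>c\<close> to \<open>v\<close>.\<close>
  obtain w v ys where l: "l = w # v # ys"
    using assms(3) by (auto simp: Suc_le_length_iff numeral_2_eq_2)
  obtain Ls1 Ls2 where Ls: "Ls = Ls1 @ (w # v # ys) # Ls2"
    using assms(2) l by (meson split_list)
  let ?Ls' = "Ls1 @ (v # ys) # Ls2"
  have legs: "spider_legs c ?Ls'" and w: "w \<notin> pverts (spider c ?Ls')"
    using assms(1) unfolding Ls by (auto simp: spider_legs_def)
  have "spider c Ls = subdivide (spider c ?Ls') (c, v) w"
    using spider_subdivide(2)[of c Ls1 "[]" v ys Ls2 w] legs w Ls by simp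
  moreover have "(c, v) \<in> parcs (spider c ?Ls')" by (simp add: parcs_spider)
  ultimately show thesis using that[of ?Ls' "(c, v)" w] legs w Ls by simp
qed

text \<open>Suppressing vertices on long legs decreases the total leg length until every leg is a
  single vertex, and then the spider is a star.\<close>

lemma spider_subdivision_of_star:
  assumes "spider_legs c Ls" "Ls \<noteq> []"
  shows "\<exists>m S. m \<ge> 1 \<and> K\<^bsub>1,m\<^esub> (with_proj S) \<and> subdivision_pair S (spider c Ls)"
  using assms
proof (induction "length (concat Ls)" arbitrary: Ls rule: less_induct)
  case less
  show ?case
  proof (cases "\<exists>l\<in>set Ls. length l \<ge> 2")
    case True
    then obtain Ls' e w where "spider_legs c Ls'" "Ls' \<noteq> []"
        "length (concat Ls') < length (concat Ls)" "e \<in> parcs (spider c Ls')"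
        "w \<notin> pverts (spider c Ls')" "spider c Ls = subdivide (spider c Ls') e w"
      using spider_unsubdivide[OF less.prems(1)] by metis
    then show ?thesis using less.hyps[of Ls'] subdivision_pair_divide by metis
  next
    case False
    have "l = [hd l]" if "l \<in> set Ls" for l
    proof -
      have "length l = 1"
        using that False spider_legs_nonempty[OF less.prems(1) that]
        by (metis One_nat_def Suc_leI le_antisym length_greater_0_conv not_less_eq_eq numeral_2_eq_2)
      then show ?thesis by (cases l) auto
    qed
    then have Ls: "Ls = map (\<lambda>x. [x]) (map hd Ls)" by (simp add: map_idI comp_def)
    define xs where "xs = map hd Ls"
    have star: "spider c Ls = \<lparr>pverts = {c} \<union> set xs, parcs = {c} \<times> set xs \<union> set xs \<times> {c}\<rparr>"
      unfolding xs_def by (subst Ls) (rule spider_star)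
    have "distinct (c # concat (map (\<lambda>x. [x]) xs))"
      using less.prems(1) Ls unfolding spider_legs_def xs_def by metis
    then have xs: "c \<notin> set xs" "card (set xs) = length Ls"
      using distinct_card[of xs] by (simp_all add: comp_def) (simp add: xs_def)
    have "K\<^bsub>1,length Ls\<^esub> (with_proj (spider c Ls))"
      unfolding complete_bipartite_digraph_pair_def star
      by (rule conjI, simp, rule exI[of _ "{c}"], rule exI[of _ "set xs"]) (simp add: xs)
    moreover have "length Ls \<ge> 1" using less.prems(2) by (cases Ls) auto
    moreover have "subdivision_pair (spider c Ls) (spider c Ls)"
    proof -
      interpret pair_graph "spider c Ls" using less.prems(1) by (rule pair_graph_spider)
      show ?thesis by (rule subdivision_pair_base) unfold_locales
    qed
    ultimately show ?thesis by blast
  qed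
qed

text \<open>The long leg supplies the final subdivision that \<open>subdivided_star\<close>
  demands.\<close>

lemma subdivided_star_spider:
  assumes "spider_legs c Ls" "l \<in> set Ls" "length l \<ge> 2"
  shows "subdivided_star (spider c Ls)"
proof -
  obtain Ls' e w where *: "spider_legs c Ls'" "Ls' \<noteq> []" "e \<in> parcs (spider c Ls')"
      "w \<notin> pverts (spider c Ls')" "spider c Ls = subdivide (spider c Ls') e w"
    using spider_unsubdivide[OF assms] by metis
  then show ?thesis
    unfolding subdivided_star_def using spider_subdivision_of_star[OF *(1,2)] by blast
qed


section \<open>Counting\<close>

lemma ex_spider_legs:
  assumes "0 \<notin> set ks"
  shows "\<exists>Ls. spider_legs (0 :: nat) Ls \<and> map length Ls = ks"
  using assms
proof (induction ks)
  case Nil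
  then show ?case by (simp add: spider_legs_def)
next
  case (Cons k ks)
  then obtain Ls where Ls: "spider_legs (0 :: nat) Ls" "map length Ls = ks" by auto
  \<comment> \<open>The new leg is an interval of numbers above all vertices in use; listing the
    centre \<open>0\<close> keeps the maximum defined when there are no legs yet.\<close>
  define m where "m = Suc (Max (set (0 # concat Ls)))"
  have m: "x < m" if "x \<in> set (0 # concat Ls)" for x
    unfolding m_def using that by (intro le_imp_less_Suc Max_ge) auto
  have "set [m..<m + k] \<inter> set (0 # concat Ls) = {}" using m by fastforce
  moreover have "k > 0" using Cons.prems by auto
  then have "[] \<noteq> [m..<m + k]" by (simp add: eq_commute[of "[]"])
  ultimately have "spider_legs 0 ([m..<m + k] # Ls)"
    using Ls(1) by (simp add: spider_legs_def)
  then show ?case using Ls(2) by (intro exI[of _ "[m..<m + k] # Ls"]) simp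
qed

lemma distinct_iff_count_le_1: "distinct xs \<longleftrightarrow> (\<forall>x. count (mset xs) x \<le> 1)"
proof
  assume *: "\<forall>x. count (mset xs) x \<le> 1"
  have "count (mset xs) x = (if x \<in> set xs then 1 else 0)" for x
    using * by (simp add: le_Suc_eq)
  then show "distinct xs" unfolding distinct_count_atmost_1 by blast
qed (simp add: distinct_count_atmost_1)

text \<open>If all legs had length one, distinct lengths would allow one leg only.\<close>

lemma distinct_lengths_long_leg:
  assumes "spider_legs c Ls" "length Ls \<ge> 3" "distinct (map length Ls)"
  shows "\<exists>l\<in>set Ls. length l \<ge> 2"
proof (rule ccontr)
  assume "\<not> ?thesis"
  then have "set (map length Ls) \<subseteq> {1}"
    using spider_legs_nonempty[OF assms(1)] by (fastforce simp: not_le less_Suc_eq numeral_2_eq_2)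
  then have "card (set (map length Ls)) \<le> card {1 :: nat}" by (rule card_mono[rotated]) simp
  then show False using assms(2) distinct_card[OF assms(3)] by simp
qed

theorem mainTheorem1:
  fixes n :: nat
  assumes "n \<ge> 1"
  shows "card ({G :: nat pair_pre_digraph.
                  pair_graph G \<and> card (pverts G) = n \<and> subdivided_star G \<and> asymmetric G}
               // graph_iso_rel)
       = card {P. partition_of P (n - 1) \<and> size P \<ge> 3 \<and> (\<forall>k. count P k \<le> 1)}"
    (is "card (?A // _) = card ?S")
proof -
  have ex: "\<exists>Ls. spider_legs (0::nat) Ls \<and> mset (map length Ls) = P" if "P \<in> ?S" for P
  proof -
    obtain ks where "mset ks = P" using ex_mset by blast
    moreover have "0 \<notin> set ks" using that calculation by (auto simp: partition_of_def)
    ultimately show ?thesis using ex_spider_legs by metis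
  qed
  \<comment> \<open>One spider with centre \<open>0\<close> is chosen for each partition;
    \<open>T P\<close> below represents the isomorphism class assigned to \<open>P\<close>.\<close>
  define legs where "legs P = (SOME Ls. spider_legs (0::nat) Ls \<and> mset (map length Ls) = P)" for P
  have legs: "spider_legs 0 (legs P)" "mset (map length (legs P)) = P" if "P \<in> ?S" for P
    using someI_ex[OF ex[OF that]] unfolding legs_def by auto
  define T where "T P = spider 0 (legs P)" for P
  have T_in: "T P \<in> ?A" and len: "length (legs P) \<ge> 3" if P: "P \<in> ?S" for P
  proof -
    note [simp] = legs(2)[OF P]
    show len: "length (legs P) \<ge> 3"
      using P arg_cong[OF legs(2)[OF P], of size] by simp
    have dist: "distinct (map length (legs P))"
      unfolding distinct_iff_count_le_1 using P legs(2)[OF P] by auto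
    have "sum_list (map length (legs P)) = n - 1"
      using P legs(2)[OF P] by (metis (lifting) mem_Collect_eq partition_of_def sum_mset_sum_list)
    \<comment> \<open>The centre is the vertex not counted by the legs; \<open>n \<ge> 1\<close>
      ensures that truncated subtraction gives \<open>Suc (n - 1) = n\<close>.\<close>
    then have "card (pverts (T P)) = n"
      using card_pverts_spider[OF legs(1)[OF P]] assms by (simp add: T_def)
    moreover have "subdivided_star (T P)"
      using distinct_lengths_long_leg[OF legs(1)[OF P] len dist] subdivided_star_spider[OF legs(1)[OF P]]
      by (auto simp: T_def)
    moreover have "asymmetric (T P)"
      unfolding T_def by (rule asymmetric_spiderI[OF legs(1)[OF P] len dist])
    moreover have "pair_graph (T P)"
      unfolding T_def by (rule pair_graph_spider[OF legs(1)[OF P]])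
    ultimately show "T P \<in> ?A" by blast
  qed
  have wf: "wf_digraph (with_proj G)" if "G \<in> ?A" for G
  proof -
    interpret pair_graph G using that by simp
    show ?thesis ..
  qed
  have "bij_betw (\<lambda>P. graph_iso_rel `` {T P}) ?S (?A // graph_iso_rel)"
  proof (rule bij_betw_imageI)
    show "inj_on (\<lambda>P. graph_iso_rel `` {T P}) ?S"
    proof (rule inj_onI)
      fix P Q assume P: "P \<in> ?S" and Q: "Q \<in> ?S" and eq: "graph_iso_rel `` {T P} = graph_iso_rel `` {T Q}"
      have "T Q \<in> graph_iso_rel `` {T Q}"
        using pair_wf_digraph_spider[OF legs(1)[OF Q]]
        by (simp add: graph_iso_rel_def T_def digraph_iso_refl)
      then have "digraph_iso (with_proj (T P)) (with_proj (T Q))"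
        unfolding eq[symmetric] by (simp add: graph_iso_rel_def)
      then show "P = Q"
        using mset_lengths_if_spider_iso[OF legs(1)[OF P] legs(1)[OF Q] len[OF Q]] legs(2) P Q
        by (simp add: T_def)
    qed
    \<comment> \<open>Surjectivity: \<open>G\<close> lies in the class of the spider chosen for its
      own multiset of leg lengths.\<close>
    have "\<exists>P\<in>?S. graph_iso_rel `` {G} = graph_iso_rel `` {T P}" if G: "G \<in> ?A" for G
    proof -
      obtain c Ls where Ls: "spider_legs c Ls" "Ls \<noteq> []" "G = spider c Ls"
        using G spider_if_subdivided_star by auto
      define P where "P = mset (map length Ls)"
      have "length Ls \<ge> 3" "distinct (map length Ls)"
        using G Ls asymmetric_spider_length asymmetric_spider_distinct_lengths by auto
      moreover have "sum_mset P = n - 1"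
        unfolding P_def sum_mset_sum_list using G card_pverts_spider[OF Ls(1)] Ls(3) by auto
      moreover have "0 \<notin># P" using spider_legs_nonempty[OF Ls(1)] by (auto simp: P_def)
      ultimately have P: "P \<in> ?S"
        by (auto simp: P_def partition_of_def distinct_iff_count_le_1)
      have "digraph_iso (with_proj G) (with_proj (T P))"
        unfolding Ls(3) T_def
        by (rule spider_iso_if_mset_lengths[OF Ls(1) legs(1)[OF P]]) (simp only: legs(2)[OF P], simp only: P_def)
      \<comment> \<open>Isomorphism in both directions, with transitivity, makes the two classes
        equal.\<close>
      note iso = this digraph_iso_swap[OF wf[OF G] this]
      have "graph_iso_rel `` {G} = graph_iso_rel `` {T P}"
        using digraph_iso_trans[OF iso(1)] digraph_iso_trans[OF iso(2)]
        unfolding graph_iso_rel_def by (intro set_eqI iffI) simp_all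
      then show ?thesis using P by blast
    qed
    then show "(\<lambda>P. graph_iso_rel `` {T P}) ` ?S = ?A // graph_iso_rel"
      unfolding quotient_def using T_in by blast
  qed
  from bij_betw_same_card[OF this] show ?thesis by (rule sym)
qed

end
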